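(* For every positive integer $n$, every triangle-free graph on $n$ vertices contains at most $\left(\frac{n}{5}\right)^5$ cycles of length 5.
   Context: Graphs are finite and simple. A cycle of length 5 is a subgraph isomorphic to $C_5$, counted as an unlabelled subgraph. *)

theory Defs
  imports Complex_Main
begin

definition simple_graph :: "'a set \<Rightarrow> 'a set set \<Rightarrow> bool" where
  "simple_graph V Ed \<longleftrightarrow> finite V \<and> (\<forall>e\<in>Ed. card e = 2 \<and> e \<subseteq> V)"

definition triangle_free :: "'a set set \<Rightarrow> bool" where
  "triangle_free Ed \<longleftrightarrow>
     \<not> (\<exists>x y z. {x, y} \<in> Ed \<and> {y, z} \<in> Ed \<and> {x, z} \<in> Ed)"

text \<open>The 5-cycles of the graph, as unlabelled subgraphs (identified by their edge sets).\<close>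
definition five_cycles :: "'a set set \<Rightarrow> 'a set set set" where
  "five_cycles Ed = {C. \<exists>v0 v1 v2 v3 v4.
      distinct [v0, v1, v2, v3, v4] \<and>
      C = {{v0, v1}, {v1, v2}, {v2, v3}, {v3, v4}, {v4, v0}} \<and> C \<subseteq> Ed}"

end

theory Submission
  imports Defs
begin

text \<open>
  The proof is a flag algebra certificate in finite form. For vertices \<open>x, y, z\<close> spanning a fixed
  graph and an integer weight for each possible neighbourhood of a further vertex in \<open>{x, y, z}\<close>, the
  sum over \<open>u, v\<close> of the product of the weights of \<open>u\<close> and \<open>v\<close> is a square. Subtracting
  a positive combination of ten such squares and \<open>10000\<close> times the number of closed walks of length
  5 from \<open>32 n\<^sup>5\<close> leaves a sum over all 5-tuples of vertices of a quantity depending only on the graph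
  that the tuple spans. Its total over all labellings of each of the 14 triangle-free graphs on 5
  vertices is nonnegative, so there are at most \<open>2 n\<^sup>5 / 625\<close> closed walks of length 5, and
  each 5-cycle accounts for 10 of them. The squares vanish on the balanced blow-ups of the pentagon,
  where the bound is attained. Repeated vertices in a tuple are harmless, as they behave like
  nonadjacent twins; this is why the bound is free of lower-order terms.
\<close>

section \<open>Five-vertex graphs, relabellings and the certificate\<close>

text \<open>
  A graph on the labelled vertices \<open>x, y, z, u, v\<close> is the list of its ten adjacencies in the order
  \<open>xy, xz, xu, xv, yz, yu, yv, zu, zv, uv\<close>. The functions evaluated on these lists are recursive and
  take all arguments at once, because \<open>code_simp\<close> would otherwise expand them symbolically under
  abstractions.
\<close>

definition swap_labels :: "nat \<Rightarrow> bool list \<Rightarrow> bool list" where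
  "swap_labels k G = (case G of
     [xy, xz, xu, xv, yz, yu, yv, zu, zv, uv] \<Rightarrow>
       if k = 0 then [xy, yz, yu, yv, xz, xu, xv, zu, zv, uv]
       else if k = 1 then [xz, xy, xu, xv, yz, zu, zv, yu, yv, uv]
       else if k = 2 then [xy, xu, xz, xv, yu, yz, yv, zu, uv, zv]
       else [xy, xz, xv, xu, yz, yv, yu, zv, zu, uv]
   | _ \<Rightarrow> G)"

fun lex_less :: "bool list \<Rightarrow> bool list \<Rightarrow> bool" where
  "lex_less (a # as) (b # bs) = (if a = b then lex_less as bs else b)"
| "lex_less _ _ = False"

fun swap_labels_list :: "nat list \<Rightarrow> bool list \<Rightarrow> bool list" where
  "swap_labels_list [] G = G"
| "swap_labels_list (k # ks) G = swap_labels_list ks (swap_labels k G)"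

definition lower :: "nat list \<Rightarrow> bool list \<Rightarrow> bool list" where
  "lower ks G = (let H = swap_labels_list ks G in if lex_less H G then H else G)"

fun lower_all :: "nat list list \<Rightarrow> bool list \<Rightarrow> bool list" where
  "lower_all [] G = G"
| "lower_all (ks # kss) G = lower_all kss (lower ks G)"

text \<open>
  The relabellings were found by a greedy search: with them, isomorphic triangle-free graphs have the
  same normal form. Only the success of the final evaluation depends on this.
\<close>
definition normal_form :: "bool list \<Rightarrow> bool list" where
  "normal_form G = lower_all
     [[0, 2], [1, 2, 1], [0], [1, 0], [3, 2, 1], [2], [1], [0, 1, 3], [3], [2],
      [0, 2, 1, 3, 2], [1, 0, 2, 1, 3, 2]] G"

definition has_triangle :: "bool list \<Rightarrow> bool" where
  "has_triangle G = (case G of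
     [xy, xz, xu, xv, yz, yu, yv, zu, zv, uv] \<Rightarrow>
       xy \<and> yz \<and> xz \<or> xy \<and> yu \<and> xu \<or> xy \<and> yv \<and> xv \<or> xz \<and> zu \<and> xu \<or> xz \<and> zv \<and> xv \<or>
       xu \<and> uv \<and> xv \<or> yz \<and> zu \<and> yu \<or> yz \<and> zv \<and> yv \<or> yu \<and> uv \<and> yv \<or> zu \<and> uv \<and> zv
   | _ \<Rightarrow> False)"

text \<open>
  The neighbourhood \<open>(p, q, r)\<close> of a vertex in \<open>(x, y, z)\<close> is read as a binary number.
\<close>
fun weight :: "int list \<Rightarrow> bool \<times> bool \<times> bool \<Rightarrow> int" where
  "weight w (p, q, r) = w ! (if p then if q then if r then 7 else 6 else if r then 5 else 4
                             else if q then if r then 3 else 2 else if r then 1 else 0)"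

text \<open>
  Each entry consists of a coefficient, the adjacencies \<open>(xy, xz, yz)\<close> and the eight weights. It is a
  rounded solution of the semidefinite program of the flag algebra method.
\<close>
definition squares :: "(int \<times> (bool \<times> bool \<times> bool) \<times> int list) list" where
  "squares =
    [(2, (False, False, False), [4, -7, -7, 5, -7, 5, 5, -6]),
     (126, (False, False, False), [0, 1, 1, -1, 1, -1, -1, 0]),
     (120, (False, False, False), [0, 0, -1, -1, 1, 1, 0, 0]),
     (205, (True, False, False), [0, -2, 1, -1, 1, -1, 0, 0]),
     (39, (True, False, False), [4, -4, -3, 1, -3, 1, 0, 0]),
     (204, (True, False, False), [0, 0, -1, 0, 1, 0, 0, 0]),
     (2796, (True, False, False), [0, 0, 0, -1, 0, 1, 0, 0]),
     (62, (False, True, True), [4, 0, 1, 0, 1, 0, -2, 0]),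
     (256, (False, True, True), [2, -1, 1, 0, 1, 0, 0, 0]),
     (2574, (False, True, True), [0, 0, -1, 0, 1, 0, 0, 0])]"

fun square_sum ::
  "(int \<times> (bool \<times> bool \<times> bool) \<times> int list) list \<Rightarrow> bool \<times> bool \<times> bool \<Rightarrow>
   bool \<times> bool \<times> bool \<Rightarrow> bool \<times> bool \<times> bool \<Rightarrow> int" where
  "square_sum [] t p q = 0"
| "square_sum ((k, s, w) # sqs) t p q =
     (if s = t then k * (weight w p * weight w q) else 0) + square_sum sqs t p q"

text \<open>The ratio \<open>32 / 10000 = 2 / 625\<close> is the density of closed 5-walks in a
  balanced blow-up of the pentagon. Only the cyclic order \<open>x, y, z, u, v\<close> is charged;
  other labellings are accounted for by the tally.\<close>

definition slack :: "bool list \<Rightarrow> int" where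
  "slack G = (case G of
     [xy, xz, xu, xv, yz, yu, yv, zu, zv, uv] \<Rightarrow>
       32 - 10000 * of_bool (xy \<and> yz \<and> zu \<and> uv \<and> xv) -
       square_sum squares (xy, xz, yz) (xu, yu, zu) (xv, yv, zv)
   | _ \<Rightarrow> 0)"

definition codes :: "bool list list" where
  "codes = List.n_lists 10 [False, True]"

fun insert_tally :: "'b \<Rightarrow> int \<Rightarrow> ('b \<times> int) list \<Rightarrow> ('b \<times> int) list" where
  "insert_tally R c [] = [(R, c)]"
| "insert_tally R c ((R', c') # xs) =
     (if R = R' then (R', c + c') # xs else (R', c') # insert_tally R c xs)"

fun tally :: "bool list list \<Rightarrow> (bool list \<times> int) list" where
  "tally [] = []"
| "tally (G # Gs) =
     (if has_triangle G then tally Gs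
      else insert_tally (normal_form G) (slack G) (tally Gs))"

text \<open>A single slack can be negative: the pentagon in the order \<open>x, y, z, u, v\<close>
  has \<open>32 - 10000\<close>. Pooling over normal forms compensates for this, which is a finite
  computation.\<close>

lemma tally_nonneg: "list_all (\<lambda>(R, c). 0 \<le> c) (tally codes)"
  by code_simp

section \<open>Sums over 5-tuples\<close>

definition sum5 :: "'a set \<Rightarrow> ('a \<Rightarrow> 'a \<Rightarrow> 'a \<Rightarrow> 'a \<Rightarrow> 'a \<Rightarrow> int) \<Rightarrow> int" where
  "sum5 V f = (\<Sum>x\<in>V. \<Sum>y\<in>V. \<Sum>z\<in>V. \<Sum>u\<in>V. \<Sum>v\<in>V. f x y z u v)"

lemma sum5_add: "sum5 V (\<lambda>x y z u v. f x y z u v + g x y z u v) = sum5 V f + sum5 V g"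
  by (simp add: sum5_def sum.distrib)

lemma sum5_diff: "sum5 V (\<lambda>x y z u v. f x y z u v - g x y z u v) = sum5 V f - sum5 V g"
  by (simp add: sum5_def sum_subtractf)

lemma sum5_mult: "sum5 V (\<lambda>x y z u v. c * f x y z u v) = c * sum5 V f"
  by (simp add: sum5_def sum_distrib_left)

lemma sum5_const: "sum5 V (\<lambda>x y z u v. c) = int (card V) ^ 5 * c"
  by (simp add: sum5_def eval_nat_numeral mult_ac)

lemma sum5_sum:
  assumes "finite A"
  shows "sum5 V (\<lambda>x y z u v. \<Sum>i\<in>A. f i x y z u v) = (\<Sum>i\<in>A. sum5 V (f i))"
  using assms
proof induction
  case empty
  show ?case by (simp add: sum5_def)
next
  case (insert i A)
  then show ?case by (simp add: sum5_add)
qed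

lemma sum5_swap:
  "sum5 V (\<lambda>x y z u v. f y x z u v) = sum5 V f"
  "sum5 V (\<lambda>x y z u v. f x z y u v) = sum5 V f"
  "sum5 V (\<lambda>x y z u v. f x y u z v) = sum5 V f"
  "sum5 V (\<lambda>x y z u v. f x y z v u) = sum5 V f"
  unfolding sum5_def
proof goal_cases
  case 1
  show ?case by (rule sum.swap)
next
  case 2
  show ?case by (rule sum.cong[OF refl], rule sum.swap)
next
  case 3
  show ?case by (rule sum.cong[OF refl], rule sum.cong[OF refl], rule sum.swap)
next
  case 4
  show ?case by (rule sum.cong[OF refl], rule sum.cong[OF refl], rule sum.cong[OF refl], rule sum.swap)
qed

lemma swap_labels_swap_labels: "swap_labels k (swap_labels k G) = G"
  by (auto simp: swap_labels_def split: list.split)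

section \<open>Counting tuples by the graph they span\<close>

locale triangle_free_adjacency =
  fixes V :: "'a set" and adj :: "'a \<Rightarrow> 'a \<Rightarrow> bool"
  assumes finite_V: "finite V"
    and adj_commute: "adj x y = adj y x"
    and no_triangle: "\<not> (adj x y \<and> adj y z \<and> adj x z)"
begin

definition code :: "'a \<Rightarrow> 'a \<Rightarrow> 'a \<Rightarrow> 'a \<Rightarrow> 'a \<Rightarrow> bool list" where
  "code x y z u v =
     [adj x y, adj x z, adj x u, adj x v, adj y z, adj y u, adj y v, adj z u, adj z v, adj u v]"

definition count :: "bool list \<Rightarrow> int" where
  "count G = sum5 V (\<lambda>x y z u v. of_bool (code x y z u v = G))"

lemma swap_labels_code:
  "swap_labels k (code x y z u v) =
     (if k = 0 then code y x z u v else if k = 1 then code x z y u v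
      else if k = 2 then code x y u z v else code x y z v u)"
  by (auto simp: swap_labels_def code_def adj_commute)

lemma count_nonneg: "0 \<le> count G"
  by (simp add: count_def sum5_def sum_nonneg)

text \<open>As \<open>swap_labels k\<close> is an involution, it can be moved from \<open>G\<close>
  to the code of the tuple, where it transposes two neighbouring summation variables.\<close>

lemma count_swap_labels: "count (swap_labels k G) = count G"
proof -
  have "(code x y z u v = swap_labels k G) = (swap_labels k (code x y z u v) = G)" for x y z u v
    by (metis swap_labels_swap_labels)
  then have "count (swap_labels k G) = sum5 V (\<lambda>x y z u v. of_bool (swap_labels k (code x y z u v) = G))"
    by (simp add: count_def)
  also have "\<dots> = count G"
  proof -
    consider "k = 0" | "k = 1" | "k = 2" | "k \<noteq> 0" "k \<noteq> 1" "k \<noteq> 2" by blast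
    then show ?thesis
      by cases (simp_all add: swap_labels_code count_def
          sum5_swap[of V "\<lambda>x y z u v. of_bool (code x y z u v = G)"])
  qed
  finally show ?thesis .
qed

lemma count_swap_labels_list: "count (swap_labels_list ks G) = count G"
  by (induction ks G rule: swap_labels_list.induct) (simp_all add: count_swap_labels)

lemma count_lower_all: "count (lower_all kss G) = count G"
  by (induction kss G rule: lower_all.induct) (simp_all add: lower_def Let_def count_swap_labels_list)

lemma count_normal_form: "count (normal_form G) = count G"
  unfolding normal_form_def by (rule count_lower_all)

lemma not_has_triangle_code: "\<not> has_triangle (code x y z u v)"
  using no_triangle[of x y z] no_triangle[of x y u] no_triangle[of x y v]
    no_triangle[of x z u] no_triangle[of x z v] no_triangle[of x u v]
    no_triangle[of y z u] no_triangle[of y z v] no_triangle[of y u v] no_triangle[of z u v]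
  by (simp add: has_triangle_def code_def)

lemma count_has_triangle:
  assumes "has_triangle G"
  shows "count G = 0"
proof -
  have "code x y z u v \<noteq> G" for x y z u v
    using assms not_has_triangle_code by blast
  then show ?thesis
    by (simp add: count_def sum5_def)
qed

lemma sum_list_insert_tally:
  "(\<Sum>(R, c)\<leftarrow>insert_tally R' c' xs. c * count R) =
     c' * count R' + (\<Sum>(R, c)\<leftarrow>xs. c * count R)"
  by (induction R' c' xs rule: insert_tally.induct) (auto simp: algebra_simps)

text \<open>Graphs with the same normal form have the same \<open>count\<close>, so their slacks may
  be pooled; graphs with a triangle have count 0.\<close>

lemma sum_list_tally:
  "(\<Sum>(R, c)\<leftarrow>tally Gs. c * count R) = (\<Sum>G\<leftarrow>Gs. slack G * count G)"
  by (induction Gs)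
    (simp_all add: sum_list_insert_tally count_normal_form count_has_triangle)

lemma sum5_code:
  "sum5 V (\<lambda>x y z u v. F (code x y z u v)) = (\<Sum>G\<leftarrow>codes. F G * count G)"
proof -
  have dist: "distinct codes"
    by (simp add: codes_def distinct_n_lists)
  have mem: "code x y z u v \<in> set codes" for x y z u v
    by (auto simp: codes_def code_def set_n_lists)
  have "F (code x y z u v) = (\<Sum>G\<in>set codes. F G * of_bool (code x y z u v = G))" for x y z u v
    using mem[of x y z u v] by (simp add: of_bool_def if_distrib cong: if_cong)
  then have "sum5 V (\<lambda>x y z u v. F (code x y z u v)) =
      (\<Sum>G\<in>set codes. F G * count G)"
    by (simp only: sum5_sum[OF finite_set] sum5_mult count_def)
  also have "\<dots> = (\<Sum>G\<leftarrow>codes. F G * count G)"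
    using dist by (simp add: sum_list_distinct_conv_sum_set)
  finally show ?thesis .
qed

lemma sum5_slack_nonneg: "0 \<le> sum5 V (\<lambda>x y z u v. slack (code x y z u v))"
proof -
  have "0 \<le> (\<Sum>(R, c)\<leftarrow>tally codes. c * count R)"
    using tally_nonneg count_nonneg by (intro sum_list_nonneg) (auto simp: list_all_iff)
  then show ?thesis
    by (simp add: sum5_code sum_list_tally)
qed

text \<open>For fixed \<open>x, y, z\<close> the condition \<open>P\<close> is constant and
  \<open>u, v\<close> range independently over \<open>V\<close>, so the inner double sum is 0 or
  \<open>k\<close> times a square.\<close>

lemma sum5_square_nonneg:
  fixes f :: "'a \<Rightarrow> 'a \<Rightarrow> 'a \<Rightarrow> 'a \<Rightarrow> int"
  assumes "0 \<le> k"
  shows "0 \<le> sum5 V (\<lambda>x y z u v. if P x y z then k * (f x y z u * f x y z v) else 0)"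
proof -
  have pos: "0 \<le> (\<Sum>u\<in>V. \<Sum>v\<in>V. if P x y z then k * (f x y z u * f x y z v) else 0)" for x y z
  proof -
    have "(\<Sum>u\<in>V. \<Sum>v\<in>V. f x y z u * f x y z v) = (\<Sum>u\<in>V. f x y z u)\<^sup>2"
      by (simp add: power2_eq_square sum_product)
    then have "(\<Sum>u\<in>V. \<Sum>v\<in>V. k * (f x y z u * f x y z v)) = k * (\<Sum>u\<in>V. f x y z u)\<^sup>2"
      by (simp flip: sum_distrib_left)
    then show ?thesis
      using assms by (cases "P x y z") simp_all
  qed
  show ?thesis
    unfolding sum5_def by (rule sum_nonneg, rule sum_nonneg, rule sum_nonneg, rule pos)
qed

lemma sum5_square_sum_nonneg:
  assumes "\<forall>(k, s, w) \<in> set sqs. 0 \<le> k"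
  shows "0 \<le> sum5 V (\<lambda>x y z u v. square_sum sqs (adj x y, adj x z, adj y z)
           (adj x u, adj y u, adj z u) (adj x v, adj y v, adj z v))"
  using assms
proof (induction sqs)
  case Nil
  show ?case by (simp add: sum5_const)
next
  case (Cons q sqs)
  obtain k s w where q: "q = (k, s, w)"
    using prod_cases3 by blast
  have "0 \<le> sum5 V (\<lambda>x y z u v. if s = (adj x y, adj x z, adj y z)
      then k * (weight w (adj x u, adj y u, adj z u) * weight w (adj x v, adj y v, adj z v)) else 0)"
    using Cons.prems q by (intro sum5_square_nonneg) simp
  with Cons q show ?case
    by (simp add: sum5_add del: weight.simps)
qed

theorem pentagon_homomorphisms:
  "625 * sum5 V (\<lambda>x y z u v. of_bool (adj x y \<and> adj y z \<and> adj z u \<and> adj u v \<and> adj x v))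
     \<le> 2 * int (card V) ^ 5"
proof -
  have "0 \<le> sum5 V (\<lambda>x y z u v. square_sum squares (adj x y, adj x z, adj y z)
           (adj x u, adj y u, adj z u) (adj x v, adj y v, adj z v))"
    by (rule sum5_square_sum_nonneg) (simp add: squares_def)
  moreover have "sum5 V (\<lambda>x y z u v. slack (code x y z u v)) =
      int (card V) ^ 5 * 32 -
      10000 * sum5 V (\<lambda>x y z u v. of_bool (adj x y \<and> adj y z \<and> adj z u \<and> adj u v \<and> adj x v)) -
      sum5 V (\<lambda>x y z u v. square_sum squares (adj x y, adj x z, adj y z)
           (adj x u, adj y u, adj z u) (adj x v, adj y v, adj z v))"
    by (simp add: slack_def code_def sum5_diff sum5_mult sum5_const)
  \<comment> \<open>Drop the nonnegative squares and divide by 16.\<close>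
  ultimately show ?thesis
    using sum5_slack_nonneg by linarith
qed

end

section \<open>From closed walks to 5-cycles\<close>

fun cycle_edges :: "'a \<times> 'a \<times> 'a \<times> 'a \<times> 'a \<Rightarrow> 'a set set" where
  "cycle_edges (x, y, z, u, v) = {{x, y}, {y, z}, {z, u}, {u, v}, {v, x}}"

lemma five_cycle_labellings:
  assumes "distinct [x, y, z, u, v]"
  shows "\<exists>T. card T = 10 \<and> (\<forall>t\<in>T. cycle_edges t = cycle_edges (x, y, z, u, v))"
proof (intro exI conjI)
  \<comment> \<open>The five rotations of the tuple, then those of its reversal.\<close>
  let ?T = "{(x, y, z, u, v), (y, z, u, v, x), (z, u, v, x, y), (u, v, x, y, z), (v, x, y, z, u),
             (v, u, z, y, x), (u, z, y, x, v), (z, y, x, v, u), (y, x, v, u, z), (x, v, u, z, y)}"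
  show "card ?T = 10"
    using assms by auto
  show "\<forall>t\<in>?T. cycle_edges t = cycle_edges (x, y, z, u, v)"
    by (simp add: insert_commute)
qed

lemma sum5_of_bool:
  assumes "finite V"
  shows "sum5 V (\<lambda>x y z u v. of_bool (P x y z u v)) =
           int (card {(x, y, z, u, v) \<in> V \<times> V \<times> V \<times> V \<times> V. P x y z u v})"
proof -
  have "sum5 V (\<lambda>x y z u v. of_bool (P x y z u v)) =
      (\<Sum>(x, y, z, u, v) \<in> V \<times> V \<times> V \<times> V \<times> V. of_bool (P x y z u v))"
    by (simp add: sum5_def sum.cartesian_product)
  also have "\<dots> = int (card {(x, y, z, u, v) \<in> V \<times> V \<times> V \<times> V \<times> V. P x y z u v})"
    using assms by (simp add: case_prod_unfold sum.If_cases of_bool_def Int_def mem_Times_iff)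
  finally show ?thesis .
qed

text \<open>Double counting: the fibres of \<open>cycle_edges\<close> over different 5-cycles are
  disjoint sets of closed walks, each with at least ten elements.\<close>

lemma card_five_cycles_le:
  assumes "simple_graph V Ed"
  shows "10 * card (five_cycles Ed) \<le>
    card {(x, y, z, u, v) \<in> V \<times> V \<times> V \<times> V \<times> V.
      {x, y} \<in> Ed \<and> {y, z} \<in> Ed \<and> {z, u} \<in> Ed \<and> {u, v} \<in> Ed \<and> {x, v} \<in> Ed}"
    (is "_ \<le> card ?D")
proof -
  have fin: "finite V" and sub: "\<And>e. e \<in> Ed \<Longrightarrow> e \<subseteq> V"
    using assms by (auto simp: simple_graph_def)
  have "finite (V \<times> V \<times> V \<times> V \<times> V)"
    using fin by (intro finite_cartesian_product)
  then have finD: "finite ?D"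
    by (rule rev_finite_subset) auto
  have D: "t \<in> ?D" if "cycle_edges t \<subseteq> Ed" for t
    using that sub by (cases t rule: cycle_edges.cases) (auto simp: insert_commute)
  let ?fib = "\<lambda>C. {t \<in> ?D. cycle_edges t = C}"
  have fib: "10 \<le> card (?fib C)" if C: "C \<in> five_cycles Ed" for C
  proof -
    obtain x y z u v where "distinct [x, y, z, u, v]" "C = cycle_edges (x, y, z, u, v)" "C \<subseteq> Ed"
      using C by (auto simp: five_cycles_def)
    then obtain T where "card T = 10" "\<forall>t\<in>T. cycle_edges t = C"
      using five_cycle_labellings by metis
    moreover from this \<open>C \<subseteq> Ed\<close> D have "T \<subseteq> ?fib C"
      by blast
    ultimately show ?thesis
      using finD card_mono[of "?fib C" T] by simp
  qed
  have "finite Ed"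
    using fin sub by (meson Pow_iff finite_Pow_iff finite_subset subsetI)
  then have finC: "finite (five_cycles Ed)"
    by (rule_tac finite_subset[of _ "Pow Ed"]) (auto simp: five_cycles_def)
  have "10 * card (five_cycles Ed) \<le> (\<Sum>C\<in>five_cycles Ed. card (?fib C))"
    using sum_bounded_below[of "five_cycles Ed" 10 "\<lambda>C. card (?fib C)"] fib by (simp add: mult.commute)
  also have "\<dots> = card (\<Union>C\<in>five_cycles Ed. ?fib C)"
    using finD finC by (subst card_UN_disjoint) auto
  also have "\<dots> \<le> card ?D"
    using finD by (intro card_mono) auto
  finally show ?thesis .
qed

theorem theorem2:
  fixes V :: "'a set" and Ed :: "'a set set" and n :: nat
  assumes "n > 0" and "simple_graph V Ed" and "card V = n" and "triangle_free Ed"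
  shows "real (card (five_cycles Ed)) \<le> (real n / 5) ^ 5"
proof -
  interpret triangle_free_adjacency V "\<lambda>x y. {x, y} \<in> Ed"
    using assms(2,4)
    by unfold_locales (auto simp: simple_graph_def triangle_free_def insert_commute)
  have "625 * (10 * int (card (five_cycles Ed))) \<le> 2 * int n ^ 5"
    using pentagon_homomorphisms card_five_cycles_le[OF assms(2)] assms(3)
    by (simp add: sum5_of_bool[OF finite_V])
  then have "3125 * int (card (five_cycles Ed)) \<le> int n ^ 5"
    by linarith
  then have "real_of_int (3125 * int (card (five_cycles Ed))) \<le> real_of_int (int n ^ 5)"
    by (rule of_int_le_iff[THEN iffD2])
  then show ?thesis
    by (simp add: power_divide)
qed

end
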